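(* Let $f$ satisfy $(\mathcal A)$ and let $p\ge1$. Let $y_{-1},y_0\in\mathcal H$ with $y_0\neq y_{-1}$, and define recursively for $k\ge0$ $$\lambda_k=\|y_k-y_{k-1}\|^{-\frac{p-1}{p}},\qquad y_{k+1}=\operatorname{prox}_{\lambda_k f}(y_k),$$ and assume $\nabla f(y_k)\neq0$ for all $k\ge0$ (so the iteration never stops and all $\lambda_k$ are well defined). Then $f(y_k)-\inf_{\mathcal H}f=o\big(k^{-(2-\frac1p)}\big)$ as $k\to+\infty$, and $(y_k)_{k\ge0}$ converges weakly to an element of $S=\operatorname{argmin} f$.
   Context: $\mathcal H$ is a real Hilbert space. Assumption $(\mathcal A)$: $f:\mathcal H\to\mathbb R$ is convex and continuously differentiable, $S=\operatorname{argmin}_{\mathcal H} f\neq\emptyset$, and $\nabla f$ is Lipschitz continuous on bounded subsets of $\mathcal H$. For $\lambda>0$, $\operatorname{prox}_{\lambda f}(y)=\operatorname{argmin}_{u\in\mathcal H}\{f(u)+\frac{1}{2\lambda}\|u-y\|^2\}$. *)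

theory Defs
  imports "HOL-Analysis.Analysis" "HOL-Library.Landau_Symbols"
begin

definition prox :: "real \<Rightarrow> ('a::real_inner \<Rightarrow> real) \<Rightarrow> 'a \<Rightarrow> 'a" where
  "prox lam f y = (THE u. \<forall>v. f u + (norm (u - y))\<^sup>2 / (2 * lam) \<le> f v + (norm (v - y))\<^sup>2 / (2 * lam))"

definition weakly_converges :: "(nat \<Rightarrow> 'a::real_inner) \<Rightarrow> 'a \<Rightarrow> bool" where
  "weakly_converges y x \<longleftrightarrow> (\<forall>v. (\<lambda>k. inner (y k) v) \<longlonglongrightarrow> inner x v)"

end

theory Submission
  imports Defs
begin

text \<open>
  Write \<open>F\<^sub>k = f y\<^sub>k - min f\<close>, \<open>d\<^sub>k = \<parallel>y\<^sub>k - y\<^sub>k\<^sub>-\<^sub>1\<parallel>\<close>, \<open>a = (p - 1)/p\<close> and \<open>t\<^sub>n = \<Sum>j<n. \<lambda>\<^sub>j\<close>, where \<open>\<lambda>\<^sub>j = d\<^sub>j powr (-a)\<close>.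
  The usual energy estimate makes \<open>\<lambda>\<^sub>k F\<^sub>k\<^sub>+\<^sub>1\<close> summable, hence \<open>F\<^sub>n = o(1/t\<^sub>n)\<close>, so it suffices that
  \<open>t\<^sub>n \<ge> \<kappa> n powr (1 + a)\<close>. Summation by parts together with the descent inequality
  \<open>F\<^sub>k - F\<^sub>k\<^sub>+\<^sub>1 \<ge> d\<^sub>k\<^sub>+\<^sub>1\<^sup>2 / \<lambda>\<^sub>k\<close> bounds \<open>\<Sum>k. t\<^sub>k d\<^sub>k\<^sub>+\<^sub>1\<^sup>2 d\<^sub>k powr a\<close>. Weighing this bound against the
  step sizes over the block \<open>n \<le> k < 2n\<close> by a weighted AM-GM inequality gives
  \<open>t\<^sub>2\<^sub>n\<^sub>+\<^sub>1 \<ge> c n (n t\<^sub>n) powr b\<close> with \<open>b = a/(a + 2) < 1\<close>. The growth \<open>n powr (1 + a)\<close> is the fixed point of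
  this recursion, which contracts because \<open>b < 1\<close>.

  Weak convergence follows Opial's argument. Instead of weak sequential compactness it uses that
  nested bounded closed convex sets, here the closed convex hulls of the tails of \<open>y\<close>, have a common point.
\<close>

section \<open>Nested bounded closed convex sets in Hilbert space\<close>

lemma norm_diff_eq_parallelogram:
  fixes x y :: "'a::real_inner"
  shows "(norm (x - y))\<^sup>2 = 2 * (norm x)\<^sup>2 + 2 * (norm y)\<^sup>2 - 4 * (norm ((1/2) *\<^sub>R x + (1/2) *\<^sub>R y))\<^sup>2"
  by (simp add: power2_norm_eq_inner inner_commute algebra_simps)

text \<open>Points of nearly minimal norm in each \<open>K n\<close> form a Cauchy sequence, by the
  parallelogram law, and the limit lies in every \<open>K n\<close>. This serves both for the
  existence of proximal points and for the weak limit.\<close>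

lemma nested_closed_convex_bounded_nonempty:
  fixes K :: "nat \<Rightarrow> 'a::{real_inner, complete_space} set"
  assumes cl: "\<And>n. closed (K n)" and cv: "\<And>n. convex (K n)"
    and bd: "bounded (K 0)" and ne: "\<And>n. K n \<noteq> {}"
    and dec: "\<And>m n. m \<le> n \<Longrightarrow> K n \<subseteq> K m"
  shows "(\<Inter>n. K n) \<noteq> {}"
proof -
  define r where "r n = (INF x\<in>K n. norm x)" for n
  have bb: "bdd_below (norm ` K n)" for n
    by (rule bdd_belowI[of _ 0]) auto
  have r_le: "r n \<le> norm x" if "x \<in> K n" for n x
    unfolding r_def by (rule cINF_lower[OF bb that])
  have r0: "0 \<le> r n" for n
    unfolding r_def by (rule cINF_greatest[OF ne]) auto
  have r_mono: "r m \<le> r n" if "m \<le> n" for m n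
    unfolding r_def by (rule cINF_superset_mono[OF ne bb dec[OF that]]) auto
  obtain R where R: "\<And>x. x \<in> K 0 \<Longrightarrow> norm x \<le> R"
    using bd by (auto simp: bounded_iff)
  have r_R: "r n \<le> R" for n
  proof -
    obtain x where "x \<in> K n" using ne by blast
    moreover have "x \<in> K 0" using dec[of 0 n] calculation by auto
    ultimately show ?thesis using r_le R by force
  qed
  have "\<exists>x\<in>K n. norm x < r n + 1 / real (Suc n)" for n
    using cINF_less_iff[OF ne bb, of n "r n + 1 / real (Suc n)"] unfolding r_def by simp
  then obtain x where xK: "\<And>n. x n \<in> K n" and xr: "\<And>n. norm (x n) < r n + 1 / real (Suc n)"
    by metis
  have "monoseq r" using r_mono by (auto simp: monoseq_def)
  moreover have "Bseq r"
    by (rule BseqI'[of _ R]) (use r0 r_R in auto)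
  ultimately have "convergent r" by (rule Bseq_monoseq_convergent[rotated])
  then obtain l where l: "r \<longlonglongrightarrow> l" by (auto simp: convergent_def)
  have r_l: "r n \<le> l" for n
    by (rule incseq_le[OF _ l]) (use r_mono in \<open>auto simp: incseq_def\<close>)
  \<comment> \<open>\<open>e m\<close> is what the parallelogram law gives when both points have
    norm at most \<open>l + 1 / real (Suc m)\<close> and their midpoint, in \<open>K m\<close> by
    convexity, has norm at least \<open>r m\<close>.\<close>
  define e where "e m = 4 * (l + 1 / real (Suc m))\<^sup>2 - 4 * (r m)\<^sup>2" for m
  have "(\<lambda>m. 1 / real (Suc m)) \<longlonglongrightarrow> 0"
    using LIMSEQ_inverse_real_of_nat by (simp add: inverse_eq_divide)
  then have "e \<longlonglongrightarrow> 4 * (l + 0)\<^sup>2 - 4 * l\<^sup>2"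
    unfolding e_def by (intro tendsto_intros l)
  then have e0: "e \<longlonglongrightarrow> 0" by simp
  have x_diff: "(norm (x m - x n))\<^sup>2 \<le> e m" if "m \<le> n" for m n
  proof -
    have "x n \<in> K m" using dec[OF that] xK by auto
    then have "(1/2) *\<^sub>R x m + (1/2) *\<^sub>R x n \<in> K m"
      using cv[of m] xK[of m] by (auto simp: convex_def)
    then have "r m \<le> norm ((1/2) *\<^sub>R x m + (1/2) *\<^sub>R x n)" by (rule r_le)
    then have 1: "(r m)\<^sup>2 \<le> (norm ((1/2) *\<^sub>R x m + (1/2) *\<^sub>R x n))\<^sup>2"
      using r0 by (simp add: power_mono)
    have "norm (x m) \<le> l + 1 / real (Suc m)" using xr[of m] r_l[of m] by linarith
    then have 2: "(norm (x m))\<^sup>2 \<le> (l + 1 / real (Suc m))\<^sup>2" by (simp add: power_mono)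
    have "1 / real (Suc n) \<le> 1 / real (Suc m)" using that by (simp add: frac_le)
    then have "norm (x n) \<le> l + 1 / real (Suc m)" using xr[of n] r_l[of n] by linarith
    then have 3: "(norm (x n))\<^sup>2 \<le> (l + 1 / real (Suc m))\<^sup>2" by (simp add: power_mono)
    show ?thesis
      unfolding e_def norm_diff_eq_parallelogram using 1 2 3 by linarith
  qed
  have "Cauchy x"
  proof (rule metric_CauchyI)
    fix \<epsilon> :: real assume \<epsilon>: "\<epsilon> > 0"
    have "\<forall>\<^sub>F m in sequentially. e m < (\<epsilon>/2)\<^sup>2"
      using order_tendstoD(2)[OF e0] \<epsilon> by simp
    then obtain M where M: "e M < (\<epsilon>/2)\<^sup>2" by (auto simp: eventually_sequentially)
    have near: "dist (x n) (x M) < \<epsilon>/2" if "n \<ge> M" for n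
    proof -
      have "(norm (x M - x n))\<^sup>2 < (\<epsilon>/2)\<^sup>2" using x_diff[OF that] M by linarith
      then have "norm (x M - x n) < \<epsilon>/2" by (rule power_less_imp_less_base) (use \<epsilon> in simp)
      then show ?thesis by (simp add: dist_norm norm_minus_commute)
    qed
    have "dist (x m) (x n) < \<epsilon>" if "m \<ge> M" "n \<ge> M" for m n
      using near[OF that(1)] near[OF that(2)] dist_triangle_half_l by blast
    then show "\<exists>M. \<forall>m\<ge>M. \<forall>n\<ge>M. dist (x m) (x n) < \<epsilon>" by blast
  qed
  then obtain w where w: "x \<longlonglongrightarrow> w"
    by (auto simp: Cauchy_convergent_iff convergent_def)
  have "w \<in> K n" for n
  proof (rule Lim_in_closed_set[OF cl _ _ w])
    show "\<forall>\<^sub>F k in sequentially. x k \<in> K n"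
      using dec xK by (blast intro: eventually_sequentiallyI[of n])
  qed simp
  then show ?thesis by blast
qed

section \<open>Convex functions and the proximal step\<close>

text \<open>Restricting \<open>f\<close> to the line through \<open>u\<close> and \<open>v\<close>
  reduces the claim to the tangent inequality in one real variable.\<close>

lemma convex_on_gradient_inequality:
  fixes f :: "'a::real_inner \<Rightarrow> real"
  assumes cv: "convex_on UNIV f" and grad: "(f has_derivative (\<lambda>h. inner (g u) h)) (at u)"
  shows "f u + inner (g u) (v - u) \<le> f v"
proof -
  define h where "h t = f (u + t *\<^sub>R (v - u))" for t :: real
  have "convex_on UNIV h"
  proof (rule convex_onI)
    fix t x z :: real assume t: "0 < t" "t < 1"
    have "u + ((1 - t) *\<^sub>R x + t *\<^sub>R z) *\<^sub>R (v - u)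
        = (1 - t) *\<^sub>R (u + x *\<^sub>R (v - u)) + t *\<^sub>R (u + z *\<^sub>R (v - u))"
      by (simp add: algebra_simps)
    then show "h ((1 - t) *\<^sub>R x + t *\<^sub>R z) \<le> (1 - t) * h x + t * h z"
      unfolding h_def using convex_onD[OF cv, of t "u + x *\<^sub>R (v - u)" "u + z *\<^sub>R (v - u)"] t by simp
  qed simp
  moreover have "(h has_real_derivative inner (g u) (v - u)) (at 0)"
  proof -
    have "((\<lambda>t. u + t *\<^sub>R (v - u)) has_derivative (\<lambda>t. t *\<^sub>R (v - u))) (at 0)"
      by (auto intro!: derivative_eq_intros)
    then have "((\<lambda>t. f (u + t *\<^sub>R (v - u))) has_derivative (\<lambda>t. inner (g u) (t *\<^sub>R (v - u)))) (at 0)"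
      by (rule has_derivative_compose) (use grad in simp)
    then show ?thesis
      unfolding has_field_derivative_def h_def by (simp add: mult.commute[of _ "inner (g u) (v - u)"])
  qed
  ultimately have "h 1 - h 0 \<ge> inner (g u) (v - u) * (1 - 0)"
    by (intro convex_on_imp_above_tangent[where A = UNIV]) auto
  then show ?thesis by (simp add: h_def)
qed

lemma convex_on_sublevel_convex:
  fixes f :: "'a::real_vector \<Rightarrow> real"
  assumes "convex_on UNIV f"
  shows "convex {x. f x \<le> c}"
proof (rule convexI)
  fix u v :: 'a and s t :: real
  assume uv: "u \<in> {x. f x \<le> c}" "v \<in> {x. f x \<le> c}" and st: "0 \<le> s" "0 \<le> t" "s + t = 1"
  have "f (s *\<^sub>R u + t *\<^sub>R v) \<le> s * f u + t * f v"
    using assms st by (simp add: convex_on_def)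
  also have "\<dots> \<le> c"
    using uv st by (intro convex_bound_le) auto
  finally show "s *\<^sub>R u + t *\<^sub>R v \<in> {x. f x \<le> c}" by simp
qed

lemma prox_objective_convex:
  fixes f :: "'a::real_inner \<Rightarrow> real"
  assumes "convex_on UNIV f" "lam > 0"
  shows "convex_on UNIV (\<lambda>u. f u + (norm (u - y))\<^sup>2 / (2 * lam))"
proof -
  have "convex_on UNIV (\<lambda>u. (norm (u - y))\<^sup>2)"
  proof (rule convex_onI)
    fix t :: real and u v :: 'a assume t: "0 < t" "t < 1"
    have "(1 - t) * (norm (u - y))\<^sup>2 + t * (norm (v - y))\<^sup>2 - (norm ((1 - t) *\<^sub>R u + t *\<^sub>R v - y))\<^sup>2
        = t * (1 - t) * (norm (u - v))\<^sup>2"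
      by (simp add: power2_norm_eq_inner inner_commute algebra_simps)
    moreover have "\<dots> \<ge> 0" using t by simp
    ultimately show "(norm ((1 - t) *\<^sub>R u + t *\<^sub>R v - y))\<^sup>2
        \<le> (1 - t) * (norm (u - y))\<^sup>2 + t * (norm (v - y))\<^sup>2" by linarith
  qed simp
  then have "convex_on UNIV (\<lambda>u. (1 / (2 * lam)) * (norm (u - y))\<^sup>2)"
    by (rule convex_on_cmul[rotated]) (use assms in simp)
  from convex_on_add[OF assms(1) this] show ?thesis by simp
qed

text \<open>The sublevel sets slightly above the infimum are nested, closed and convex, and bounded
  because \<open>f\<close> is bounded below; a common point attains the infimum.\<close>

lemma prox_minimizer_exists:
  fixes f :: "'a::{real_inner, complete_space} \<Rightarrow> real"
  assumes cv: "convex_on UNIV f" and cont: "continuous_on UNIV f"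
    and lb: "\<And>x. m \<le> f x" and lam: "lam > 0"
  shows "\<exists>u. \<forall>v. f u + (norm (u - y))\<^sup>2 / (2 * lam) \<le> f v + (norm (v - y))\<^sup>2 / (2 * lam)"
proof -
  define \<phi> where "\<phi> u = f u + (norm (u - y))\<^sup>2 / (2 * lam)" for u
  have cv\<phi>: "convex_on UNIV \<phi>"
    unfolding \<phi>_def using prox_objective_convex[OF cv lam] .
  have cont\<phi>: "continuous_on UNIV \<phi>"
    unfolding \<phi>_def by (intro continuous_intros cont) (use lam in auto)
  have \<phi>m: "m \<le> \<phi> u" for u
    unfolding \<phi>_def using lb[of u] lam by (simp add: add_increasing2)
  have bb: "bdd_below (range \<phi>)" by (rule bdd_belowI[of _ m]) (use \<phi>m in auto)
  define i where "i = (INF u. \<phi> u)"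
  have i_le: "i \<le> \<phi> u" for u unfolding i_def by (rule cINF_lower[OF bb]) simp
  define K where "K n = {u. \<phi> u \<le> i + 1 / real (Suc n)}" for n
  have "(\<Inter>n. K n) \<noteq> {}"
  proof (rule nested_closed_convex_bounded_nonempty)
    show "closed (K n)" for n
      unfolding K_def by (intro closed_Collect_le cont\<phi> continuous_on_const)
    show "convex (K n)" for n
      
      unfolding K_def by (rule convex_on_sublevel_convex[OF cv\<phi>])
    show "K n \<noteq> {}" for n
    proof -
      have "\<exists>u\<in>UNIV. \<phi> u < i + 1 / real (Suc n)"
        using cINF_less_iff[OF UNIV_not_empty bb, of "i + 1 / real (Suc n)"] unfolding i_def by simp
      then show ?thesis unfolding K_def using less_imp_le by blast
    qed
    show "K n \<subseteq> K k" if "k \<le> n" for k n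
    proof -
      have "1 / real (Suc n) \<le> 1 / real (Suc k)" using that by (simp add: frac_le)
      then show ?thesis unfolding K_def by auto
    qed
    show "bounded (K 0)"
    proof -
      have "norm (u - y) \<le> sqrt (2 * lam * (i + 1 - m))" if "u \<in> K 0" for u
      proof (rule real_le_rsqrt)
        have "(norm (u - y))\<^sup>2 / (2 * lam) \<le> i + 1 - m"
          using that lb[of u] unfolding K_def \<phi>_def by simp
        then show "(norm (u - y))\<^sup>2 \<le> 2 * lam * (i + 1 - m)"
          using lam by (simp add: field_simps)
      qed
      then have "K 0 \<subseteq> cball y (sqrt (2 * lam * (i + 1 - m)))"
        by (auto simp: dist_norm norm_minus_commute)
      then show ?thesis using bounded_cball bounded_subset by blast
    qed
  qed
  then obtain u where u: "\<And>n. \<phi> u \<le> i + 1 / real (Suc n)" by (auto simp: K_def)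
  have "(\<lambda>n. i + 1 / real (Suc n)) \<longlonglongrightarrow> i + 0"
    using LIMSEQ_inverse_real_of_nat by (intro tendsto_intros) (simp add: inverse_eq_divide)
  then have "\<phi> u \<le> i" using u by (intro LIMSEQ_le_const) auto
  then show ?thesis using i_le order_trans unfolding \<phi>_def by blast
qed

text \<open>The derivative of the objective vanishes at a minimum. The result is an implicit
  (backward Euler) gradient step.\<close>

lemma prox_minimizer_stationary:
  fixes f :: "'a::real_inner \<Rightarrow> real"
  assumes grad: "(f has_derivative (\<lambda>h. inner (g u) h)) (at u)" and lam: "lam > 0"
    and min: "\<And>v. f u + (norm (u - y))\<^sup>2 / (2 * lam) \<le> f v + (norm (v - y))\<^sup>2 / (2 * lam)"
  shows "u = y - lam *\<^sub>R g u"
proof -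
  define c where "c = 1 / (2 * lam)"
  have "((\<lambda>u. f u + c * inner (u - y) (u - y)) has_derivative
      (\<lambda>h. inner (g u) h + c * (inner (u - y) h + inner h (u - y)))) (at u)"
    by (auto intro!: derivative_eq_intros grad)
  then have "(\<lambda>h. inner (g u) h + c * (inner (u - y) h + inner h (u - y))) = (\<lambda>h. 0)"
    by (rule has_derivative_local_min)
      (use min in \<open>auto simp: power2_norm_eq_inner c_def\<close>)
  then have "inner (g u) h + c * (inner (u - y) h + inner h (u - y)) = 0" for h
    by meson
  then have "lam * inner (g u) h + inner (u - y) h = 0" for h
    using lam unfolding c_def by (simp add: inner_commute field_simps)
  then have "inner (lam *\<^sub>R g u + (u - y)) h = 0" for h
    by (simp only: inner_add_left inner_scaleR_left)
  then have "lam *\<^sub>R g u + (u - y) = 0" using inner_eq_zero_iff by blast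
  then show ?thesis by (simp add: algebra_simps)
qed

text \<open>\<open>prox\<close> is a definite description, so the minimizer must first be shown
  unique. Two minimizers differ by \<open>- lam\<close> times the difference of their gradients,
  whereas monotonicity of the gradient makes the inner product of the two differences nonnegative;
  hence the gradients agree, and so do the minimizers.\<close>

lemma prox_stationary:
  fixes f :: "'a::{real_inner, complete_space} \<Rightarrow> real"
  assumes cv: "convex_on UNIV f" and grad: "\<And>x. (f has_derivative (\<lambda>h. inner (g x) h)) (at x)"
    and lb: "\<And>x. m \<le> f x" and lam: "lam > 0"
  shows "prox lam f y = y - lam *\<^sub>R g (prox lam f y)"
proof -
  let ?P = "\<lambda>u. \<forall>v. f u + (norm (u - y))\<^sup>2 / (2 * lam) \<le> f v + (norm (v - y))\<^sup>2 / (2 * lam)"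
  have "continuous_on UNIV f"
    by (intro continuous_at_imp_continuous_on ballI has_derivative_continuous[OF grad])
  then obtain u where u: "?P u" using prox_minimizer_exists[OF cv _ lb lam] by blast
  have eq: "w = y - lam *\<^sub>R g w" if "?P w" for w
    using prox_minimizer_stationary[of f g w lam y, OF grad lam] that by blast
  have "w = u" if "?P w" for w
  proof -
    have "inner (g w - g u) (w - u) \<ge> 0"
      using convex_on_gradient_inequality[of f g w u, OF cv grad] convex_on_gradient_inequality[of f g u w, OF cv grad]
      by (simp add: inner_diff)
    moreover have "w - u = (y - lam *\<^sub>R g w) - (y - lam *\<^sub>R g u)"
      using eq[OF that] eq[OF u] by simp
    then have "w - u = - lam *\<^sub>R (g w - g u)" by (simp add: algebra_simps)
    ultimately have "lam * (norm (g w - g u))\<^sup>2 \<le> 0"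
      by (simp add: power2_norm_eq_inner)
    then have "g w = g u" using lam by (simp add: mult_le_0_iff)
    then show ?thesis using eq[OF that] eq[OF u] by simp
  qed
  then have "?P (THE w. ?P w)" by (rule theI[where P = ?P, OF u])
  then have "?P (prox lam f y)" by (fold prox_def)
  then show ?thesis by (rule eq)
qed


section \<open>Growth of the sums of step sizes\<close>

text \<open>Summation by parts with increments \<open>w n = t (Suc n) - t n\<close>. When the
  boundary term \<open>t n * F n\<close> is nonnegative, a bound on the weighted values also bounds
  the weighted decrements.\<close>

lemma telescoped_sum_eq:
  fixes F w t :: "nat \<Rightarrow> real"
  assumes "\<And>n. t n = (\<Sum>j<n. w j)"
  shows "(\<Sum>k<n. t k * (F k - F (Suc k))) + t n * F n = (\<Sum>k<n. w k * F (Suc k))"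
  by (induction n) (simp_all add: assms algebra_simps)

lemma one_le_weighted_sum:
  fixes a d d' \<rho> :: real
  assumes a: "a \<ge> 0" and pos: "d > 0" "d' > 0" "\<rho> > 0"
  defines "\<sigma> \<equiv> \<rho> powr (- (a / (a + 2)))"
  shows "1 \<le> \<rho> * (d'\<^sup>2 * d powr a) / 2 + \<sigma> * (d' powr (-a) + d powr (-a))"
proof -
  \<comment> \<open>Weighted AM-GM, as \<open>ln x \<le> x - 1\<close> with weights \<open>\<alpha>, \<beta>, \<alpha>\<close> chosen so that the product of the powers is 1.\<close>
  define \<alpha> \<beta> where "\<alpha> = a / (2 + 2 * a)" and "\<beta> = 1 / (1 + a)"
  have \<beta>': "\<beta> = 2 / (2 + 2 * a)" using a by (simp add: \<beta>_def field_simps)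
  have \<alpha>: "0 \<le> \<alpha>" "\<alpha> \<le> 1/2" and \<beta>: "0 \<le> \<beta>" "\<beta> \<le> 1"
    using a by (auto simp: \<alpha>_def \<beta>_def field_simps)
  have sum: "\<alpha> + \<beta> + \<alpha> = 1"
    using a unfolding \<beta>' \<alpha>_def by (simp flip: add_divide_distrib)
  \<comment> \<open>\<open>ab\<close> cancels the exponent of \<open>d'\<close> and
    \<open>\<alpha>b\<close> below that of \<open>\<rho>\<close>; the exponent of \<open>d\<close>
    cancels because \<open>?u\<close> and \<open>?w\<close> carry the same weight.\<close>
  have ab: "2 * \<alpha> = a * \<beta>" using a by (simp add: \<alpha>_def \<beta>_def field_simps)
  have "\<beta> + \<alpha> = (a + 2) / (2 + 2 * a)"
    unfolding \<beta>' \<alpha>_def by (simp flip: add_divide_distrib)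
  then have \<alpha>b: "\<alpha> = (\<beta> + \<alpha>) * (a / (a + 2))" using a by (simp add: \<alpha>_def)
  have \<sigma>: "\<sigma> > 0" using pos by (simp add: \<sigma>_def)
  let ?u = "\<rho> * (d'\<^sup>2 * d powr a)"
  let ?v = "\<sigma> * d' powr (-a)"
  let ?w = "\<sigma> * d powr (-a)"
  have pos': "?u > 0" "?v > 0" "?w > 0" using pos \<sigma> by auto
  have ln: "ln ?u = ln \<rho> + 2 * ln d' + a * ln d" "ln ?v = - (a / (a + 2)) * ln \<rho> - a * ln d'"
    "ln ?w = - (a / (a + 2)) * ln \<rho> - a * ln d"
    using pos \<sigma> by (simp_all add: ln_mult ln_powr ln_realpow \<sigma>_def)
  have "\<alpha> * ln ?u + \<beta> * ln ?v + \<alpha> * ln ?w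
      = (\<alpha> - (\<beta> + \<alpha>) * (a / (a + 2))) * ln \<rho> + (2 * \<alpha> - a * \<beta>) * ln d'"
    unfolding ln by (simp add: algebra_simps add_divide_distrib)
  also have "\<dots> = 0" using ab \<alpha>b by simp
  finally have 0: "\<alpha> * ln ?u + \<beta> * ln ?v + \<alpha> * ln ?w = 0" .
  have "\<alpha> * ln ?u \<le> \<alpha> * (?u - 1)" "\<beta> * ln ?v \<le> \<beta> * (?v - 1)" "\<alpha> * ln ?w \<le> \<alpha> * (?w - 1)"
    using \<alpha> \<beta> pos' by (auto intro!: mult_left_mono ln_le_minus_one)
  then have "1 \<le> \<alpha> * ?u + \<beta> * ?v + \<alpha> * ?w"
    using 0 sum by (simp add: right_diff_distrib)
  \<comment> \<open>The factor 1/2 is kept here so that, after summing over a block, this term can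
    be absorbed on the left.\<close>
  moreover have "\<alpha> * ?u \<le> 1/2 * ?u" by (rule mult_right_mono[OF \<alpha>(2)]) (use pos' in simp)
  moreover have "\<beta> * ?v \<le> 1 * ?v" by (rule mult_right_mono[OF \<beta>(2)]) (use pos' in simp)
  moreover have "\<alpha> * ?w \<le> 1 * ?w" by (rule mult_right_mono) (use \<alpha> pos' in auto)
  ultimately show ?thesis by (simp add: distrib_left)
qed

lemma step_sum_doubling:
  fixes d t :: "nat \<Rightarrow> real"
  assumes a: "a \<ge> 0" and d: "\<And>k. d k > 0"
    and t: "\<And>n. t n = (\<Sum>j<n. d j powr (-a))"
    and C: "\<And>n. (\<Sum>k<n. t k * ((d (Suc k))\<^sup>2 * d k powr a)) \<le> C" "C > 0"
    and n: "n \<ge> 1"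
  shows "t (2 * n + 1) \<ge> real n / 4 * (real n * t n / C) powr (a / (a + 2))"
proof -
  define u where "u k = (d (Suc k))\<^sup>2 * d k powr a" for k
  have u0: "u k \<ge> 0" for k using d by (simp add: u_def)
  have tmono: "t m \<le> t k" if "m \<le> k" for m k
    unfolding t using that by (intro sum_mono2) auto
  have tpos: "t n > 0" unfolding t using n d by (intro sum_pos) (auto simp: lessThan_empty_iff less_imp_neq[symmetric])
  have t0: "t k \<ge> 0" for k unfolding t by (intro sum_nonneg) auto
  \<comment> \<open>This weight makes \<open>\<rho>\<close> times the block sum of \<open>u\<close>
    at most \<open>n\<close>, so the first term of the weighted inequality uses up only half of the
    count \<open>n\<close>.\<close>
  define \<rho> where "\<rho> = real n * t n / C"
  have \<rho>: "\<rho> > 0" using n tpos C by (simp add: \<rho>_def)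
  define \<sigma> where "\<sigma> = \<rho> powr (- (a / (a + 2)))"
  have \<sigma>: "\<sigma> > 0" using \<rho> by (simp add: \<sigma>_def)
  have "t n * (\<Sum>k=n..<2*n. u k) \<le> (\<Sum>k=n..<2*n. t k * u k)"
    unfolding sum_distrib_left by (intro sum_mono mult_right_mono tmono u0) auto
  also have "\<dots> \<le> (\<Sum>k<2*n. t k * u k)"
    by (intro sum_mono2) (auto intro!: mult_nonneg_nonneg t0 u0)
  also have "\<dots> \<le> C" unfolding u_def by (rule C)
  finally have U: "(\<Sum>k=n..<2*n. u k) \<le> C / t n" using tpos by (simp add: field_simps)
  have "\<rho> * (\<Sum>k=n..<2*n. u k) \<le> \<rho> * (C / t n)" using U \<rho> by (intro mult_left_mono) auto
  also have "\<dots> = real n" using tpos C by (simp add: \<rho>_def)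
  finally have U': "\<rho> * (\<Sum>k=n..<2*n. u k) \<le> real n" .
  \<comment> \<open>The shifted terms reach index \<open>2 * n\<close>, which is why the bound is on
    \<open>t (2 * n + 1)\<close> and not on \<open>t (2 * n)\<close>.\<close>
  have "(\<Sum>k=n..<2*n. d (Suc k) powr (-a)) = (\<Sum>k=Suc n..<Suc (2*n). d k powr (-a))"
    by (rule sum.shift_bounds_Suc_ivl[symmetric])
  also have "\<dots> \<le> t (2 * n + 1)" unfolding t by (intro sum_mono2) auto
  finally have V: "(\<Sum>k=n..<2*n. d (Suc k) powr (-a)) \<le> t (2 * n + 1)" .
  have W: "(\<Sum>k=n..<2*n. d k powr (-a)) \<le> t (2 * n + 1)" unfolding t by (intro sum_mono2) auto
  have "real n = (\<Sum>k=n..<2*n. 1)" by simp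
  also have "\<dots> \<le> (\<Sum>k=n..<2*n. \<rho> * u k / 2 + \<sigma> * (d (Suc k) powr (-a) + d k powr (-a)))"
    unfolding u_def \<sigma>_def using one_le_weighted_sum[OF a d d \<rho>] by (intro sum_mono) auto
  also have "\<dots> = \<rho> * (\<Sum>k=n..<2*n. u k) / 2
      + \<sigma> * ((\<Sum>k=n..<2*n. d (Suc k) powr (-a)) + (\<Sum>k=n..<2*n. d k powr (-a)))"
    by (simp add: sum.distrib sum_distrib_left[symmetric] sum_divide_distrib[symmetric])
  also have "\<dots> \<le> real n / 2 + \<sigma> * (t (2 * n + 1) + t (2 * n + 1))"
    using U' V W \<sigma> by (intro add_mono mult_left_mono) auto
  finally have "real n / 4 \<le> t (2 * n + 1) * \<sigma>" by (simp add: algebra_simps)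
  then have "real n / 4 / \<sigma> \<le> t (2 * n + 1)" using \<sigma> by (simp add: divide_le_eq)
  then show ?thesis unfolding \<sigma>_def \<rho>_def powr_minus by (simp add: field_simps)
qed

text \<open>Strong induction: the bound at an index \<open>n\<close> of about \<open>m / 2\<close>
  passes through the doubling estimate to \<open>m\<close>, and a small enough
  \<open>\<kappa>\<close> reproduces itself.\<close>

lemma step_sum_growth:
  fixes d t :: "nat \<Rightarrow> real"
  assumes a: "a \<ge> 0" and d: "\<And>k. d k > 0"
    and t: "\<And>n. t n = (\<Sum>j<n. d j powr (-a))"
    and C: "\<And>n. (\<Sum>k<n. t k * ((d (Suc k))\<^sup>2 * d k powr a)) \<le> C"
  shows "\<exists>\<kappa>>0. \<forall>n\<ge>1. t n \<ge> \<kappa> * real n powr (1 + a)"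
proof -
  define b where "b = a / (a + 2)"
  \<comment> \<open>By \<open>ba\<close>, the exponent \<open>s = 1 + a\<close> solves
    \<open>s = 1 + b * (1 + s)\<close>, the balance of powers in the doubling estimate.\<close>
  have b: "0 \<le> b" "b < 1" and ba: "(2 + a) * b = a" using a by (auto simp: b_def field_simps)
  \<comment> \<open>The doubling estimate divides by its bound, so \<open>C\<close> is replaced by a
    positive one.\<close>
  define D where "D = max C 1"
  have D: "D > 0" "\<And>n. (\<Sum>k<n. t k * ((d (Suc k))\<^sup>2 * d k powr a)) \<le> D"
    using C by (auto simp: D_def le_max_iff_disj)
  have tmono: "t m \<le> t k" if "m \<le> k" for m k
    unfolding t using that by (intro sum_mono2) auto
  have t1: "t 1 > 0" using d[of 0] by (simp add: t)
  \<comment> \<open>The first factor comes from the doubling estimate, the last pays for replacing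
    \<open>m\<close> by \<open>4 * n\<close>.\<close>
  define c where "c = D powr (-b) / 4 * 4 powr (-(1 + a))"
  have c: "c > 0" using D by (simp add: c_def)
  \<comment> \<open>The first entry covers the base case \<open>m \<le> 2\<close>; the second gives
    \<open>\<kappa> \<le> c * \<kappa> powr b\<close>, which closes the induction.\<close>
  define \<kappa> where "\<kappa> = min (t 1 * 2 powr (-(1 + a))) (c powr (1 / (1 - b)))"
  have \<kappa>: "\<kappa> > 0" using t1 c by (simp add: \<kappa>_def)
  have \<kappa>t: "\<kappa> * 2 powr (1 + a) \<le> t 1"
  proof -
    have "\<kappa> * 2 powr (1 + a) \<le> t 1 * 2 powr (-(1 + a)) * 2 powr (1 + a)"
      by (intro mult_right_mono) (auto simp: \<kappa>_def)
    also have "\<dots> = t 1" by (simp add: mult.assoc flip: powr_add)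
    finally show ?thesis .
  qed
  have \<kappa>c: "\<kappa> \<le> c * \<kappa> powr b"
  proof -
    have "\<kappa> powr (1 - b) \<le> (c powr (1 / (1 - b))) powr (1 - b)"
      using \<kappa> b by (intro powr_mono2) (auto simp: \<kappa>_def)
    also have "\<dots> = c" using b c by (simp add: powr_powr)
    finally have "\<kappa> powr (1 - b) * \<kappa> powr b \<le> c * \<kappa> powr b" by (intro mult_right_mono) auto
    then show ?thesis using \<kappa> by (simp flip: powr_add)
  qed
  have "t m \<ge> \<kappa> * real m powr (1 + a)" if "m \<ge> 1" for m
    using that
  proof (induction m rule: less_induct)
    case (less m)
    show ?case
    proof (cases "m \<le> 2")
      case True
      have "\<kappa> * real m powr (1 + a) \<le> \<kappa> * 2 powr (1 + a)"
        using True a \<kappa> by (intro mult_left_mono powr_mono2) auto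
      also have "\<dots> \<le> t m" using \<kappa>t tmono[OF less.prems] by linarith
      finally show ?thesis .
    next
      case False
      \<comment> \<open>The largest \<open>n\<close> with \<open>2 * n + 1 \<le> m\<close>; it is
        positive exactly when \<open>m > 2\<close>, hence the two base cases.\<close>
      define n where "n = (m - 1) div 2"
      have n: "n \<ge> 1" "n < m" "2 * n + 1 \<le> m" "m \<le> 4 * n"
        using False unfolding n_def by presburger+
      have IH: "\<kappa> * real n powr (1 + a) \<le> t n" using less.IH n by blast
      have "\<kappa> * real m powr (1 + a) \<le> \<kappa> * (4 * real n) powr (1 + a)"
        using n(4) a \<kappa> by (intro mult_left_mono powr_mono2) linarith+
      also have "\<dots> \<le> (c * \<kappa> powr b) * (4 * real n) powr (1 + a)"
        by (intro mult_right_mono \<kappa>c) auto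
      also have "\<dots> = real n / 4 * (real n * (\<kappa> * real n powr (1 + a)) / D) powr b"
      proof -
        have "real n * ((real n powr (1 + a)) powr b * real n powr b) = real n powr (1 + (1 + a) * b + b)"
          unfolding powr_powr[of "real n" "1 + a" b] using n(1) by (simp add: powr_add)
        also have "1 + (1 + a) * b + b = 1 + a" using ba by (simp add: algebra_simps)
        finally have *: "real n * ((real n powr (1 + a)) powr b * real n powr b) = real n powr (1 + a)" .
        have "4 powr (-(1 + a)) * (4 * real n) powr (1 + a) = real n powr (1 + a)"
          by (simp add: powr_mult flip: mult.assoc powr_add)
        moreover have "(c * \<kappa> powr b) * (4 * real n) powr (1 + a)
            = D powr (-b) / 4 * \<kappa> powr b * (4 powr (-(1 + a)) * (4 * real n) powr (1 + a))"
          by (simp only: c_def mult_ac)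
        ultimately have "(c * \<kappa> powr b) * (4 * real n) powr (1 + a)
            = D powr (-b) / 4 * \<kappa> powr b * (real n * ((real n powr (1 + a)) powr b * real n powr b))"
          by (simp only: *)
        also have "\<dots> = real n / 4 * (real n * (\<kappa> * real n powr (1 + a)) / D) powr b"
          using D \<kappa> by (simp add: powr_mult powr_divide powr_minus_divide mult_ac)
        finally show ?thesis .
      qed
      also have "\<dots> \<le> real n / 4 * (real n * t n / D) powr b"
        using IH D \<kappa> b by (intro mult_left_mono powr_mono2 divide_right_mono) auto
      also have "\<dots> \<le> t (2 * n + 1)"
        unfolding b_def by (rule step_sum_doubling[OF a d t D(2,1) n(1)])
      also have "\<dots> \<le> t m" by (rule tmono[OF n(3)])
      finally show ?thesis .
    qed
  qed
  then show ?thesis using \<kappa> by blast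
qed

section \<open>From summability to a little-o rate\<close>

text \<open>Since \<open>F\<close> decreases, \<open>F n * (t n - t m)\<close> is at most a block of
  a convergent series, hence small for large \<open>m\<close>. The remainder
  \<open>t m * F n\<close> vanishes for fixed \<open>m\<close>, because the case
  \<open>m = 0\<close> already forces \<open>F\<close> to 0.\<close>

lemma antimono_weighted_tendsto_0:
  fixes F w t :: "nat \<Rightarrow> real"
  assumes F0: "\<And>k. F k \<ge> 0" and dec: "\<And>k. F (Suc k) \<le> F k" and w: "\<And>k. w k \<ge> 0"
    and t: "\<And>n. t n = (\<Sum>j<n. w j)" and tinf: "filterlim t at_top sequentially"
    and C: "\<And>n. (\<Sum>k<n. w k * F (Suc k)) \<le> C"
  shows "(\<lambda>n. t n * F n) \<longlonglongrightarrow> 0" and "F \<longlonglongrightarrow> 0"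
proof -
  have anti: "F n \<le> F m" if "m \<le> n" for m n
    using lift_Suc_antimono_le[of F, OF dec that] .
  have t0: "t n \<ge> 0" for n unfolding t by (intro sum_nonneg w)
  have sm: "summable (\<lambda>k. w k * F (Suc k))"
    by (rule bounded_imp_summable[where B = C])
      (use C[of "Suc _"] F0 w in \<open>auto simp: lessThan_Suc_atMost\<close>)
  have block: "F n * (t n - t m) \<le> (\<Sum>k=m..<n. w k * F (Suc k))" if "m \<le> n" for m n
  proof -
    have "t n - t m = (\<Sum>k=m..<n. w k)"
      unfolding t lessThan_atLeast0 using that by (simp add: sum_diff_nat_ivl)
    then have "F n * (t n - t m) = (\<Sum>k=m..<n. w k * F n)"
      by (simp add: sum_distrib_left mult.commute)
    also have "\<dots> \<le> (\<Sum>k=m..<n. w k * F (Suc k))"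
      by (intro sum_mono mult_left_mono anti w) auto
    finally show ?thesis .
  qed
  have FC: "F n * t n \<le> C" for n
    using block[of 0 n] C[of n] by (simp add: t lessThan_atLeast0)
  have "\<forall>\<^sub>F n in sequentially. t n > 0" using tinf by (simp add: filterlim_at_top_dense)
  then have "\<forall>\<^sub>F n in sequentially. F n \<le> C / t n"
    by eventually_elim (use FC in \<open>simp add: field_simps\<close>)
  moreover have "(\<lambda>n. C / t n) \<longlonglongrightarrow> 0"
    by (rule tendsto_divide_0[OF tendsto_const filterlim_at_top_imp_at_infinity[OF tinf]])
  ultimately show F: "F \<longlonglongrightarrow> 0"
    using F0 by (intro tendsto_sandwich[of "\<lambda>_. 0" F _ "\<lambda>n. C / t n"]) auto
  show "(\<lambda>n. t n * F n) \<longlonglongrightarrow> 0"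
  proof (rule LIMSEQ_I)
    fix e :: real assume e: "e > 0"
    obtain m where m: "\<And>n. m \<le> n \<Longrightarrow> norm (\<Sum>k=m..<n. w k * F (Suc k)) < e / 2"
      using sm e unfolding summable_Cauchy by (metis half_gt_zero order_refl)
    have "(\<lambda>n. t m * F n) \<longlonglongrightarrow> t m * 0" by (intro tendsto_intros F)
    then have "\<forall>\<^sub>F n in sequentially. t m * F n < e / 2"
      using order_tendstoD(2)[of _ "t m * 0" _ "e / 2"] e by simp
    then obtain N where N: "\<And>n. n \<ge> N \<Longrightarrow> t m * F n < e / 2"
      by (auto simp: eventually_sequentially)
    have "norm (t n * F n - 0) < e" if "n \<ge> max m N" for n
    proof -
      have "F n * (t n - t m) < e / 2" using block[of m n] m[of n] that by auto
      moreover have "t m * F n < e / 2" using N that by simp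
      ultimately have "t n * F n < e" by (simp add: algebra_simps)
      then show ?thesis using t0 F0 by simp
    qed
    then show "\<exists>no. \<forall>n\<ge>no. norm (t n * F n - 0) < e" by blast
  qed
qed


section \<open>Weak convergence of Fejer monotone sequences\<close>

text \<open>Points common to the closed convex hulls of all tails play the role of weak cluster
  points, and \<open>cluster\<close> puts them in \<open>S\<close>. Such a point exists and is
  unique, and the sequence converges weakly to it.\<close>

lemma fejer_monotone_weakly_converges:
  fixes y :: "nat \<Rightarrow> 'a::{real_inner, complete_space}"
  assumes fejer: "\<And>z k. z \<in> S \<Longrightarrow> norm (y (Suc k) - z) \<le> norm (y k - z)"
    and ne: "S \<noteq> {}"
    and cluster: "\<And>z. (\<And>C n. closed C \<Longrightarrow> convex C \<Longrightarrow> y ` {n..} \<subseteq> C \<Longrightarrow> z \<in> C) \<Longrightarrow> z \<in> S"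
  shows "\<exists>z\<in>S. weakly_converges y z"
proof -
  define K where "K n = (\<lambda>C. closed C \<and> convex C) hull (y ` {n..})" for n
  have KC: "K n \<subseteq> C" if "closed C" "convex C" "y ` {n..} \<subseteq> C" for C n
    unfolding K_def using that by (intro hull_minimal) auto
  have "closed (K n) \<and> convex (K n)" for n
    unfolding K_def by (rule hull_in) (auto intro: closed_Inter convex_Inter)
  then have clK: "closed (K n)" and cvK: "convex (K n)" for n by auto
  have yK: "y k \<in> K n" if "n \<le> k" for n k
    unfolding K_def using that by (intro hull_inc) auto
  have decK: "K n \<subseteq> K m" if "m \<le> n" for m n
    by (rule KC[OF clK cvK]) (use yK that in auto)
  have KS: "z \<in> S" if "\<And>n. z \<in> K n" for z
    using that KC by (intro cluster) blast
  have norm_le: "norm (y k - z) \<le> norm (y 0 - z)" if "z \<in> S" for z k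
    using lift_Suc_antimono_le[of "\<lambda>k. norm (y k - z)" 0 k] fejer[OF that] by simp
  obtain s where s: "s \<in> S" using ne by blast
  have bdK: "bounded (K 0)"
  proof -
    have "K 0 \<subseteq> cball s (norm (y 0 - s))"
      by (rule KC) (use norm_le[OF s] in \<open>auto simp: dist_norm norm_minus_commute\<close>)
    then show ?thesis using bounded_cball bounded_subset by blast
  qed
  \<comment> \<open>A half-space that eventually contains the sequence contains a tail hull, hence
    every common point.\<close>
  have half: "inner w v \<le> c" if w: "\<And>n. w \<in> K n" and ev: "\<forall>\<^sub>F k in sequentially. inner (y k) v \<le> c" for w v c
  proof -
    obtain N where "\<And>k. k \<ge> N \<Longrightarrow> inner (y k) v \<le> c"
      using ev by (auto simp: eventually_sequentially)
    then have "K N \<subseteq> {x. inner v x \<le> c}"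
      by (intro KC closed_halfspace_le convex_halfspace_le) (auto simp: inner_commute)
    then show ?thesis using w[of N] by (auto simp: inner_commute)
  qed
  have lim_unique: "inner w v = l" if w: "\<And>n. w \<in> K n" and l: "(\<lambda>k. inner (y k) v) \<longlonglongrightarrow> l" for w v l
  proof (rule antisym)
    show "inner w v \<le> l"
    proof (rule field_le_epsilon)
      fix e :: real assume "e > 0"
      then have "\<forall>\<^sub>F k in sequentially. inner (y k) v < l + e"
        by (intro order_tendstoD(2)[OF l]) simp
      then have "\<forall>\<^sub>F k in sequentially. inner (y k) v \<le> l + e" by eventually_elim simp
      then show "inner w v \<le> l + e" by (rule half[OF w])
    qed
    have "inner w (- v) \<le> - l"
    proof (rule field_le_epsilon)
      fix e :: real assume "e > 0"
      then have "\<forall>\<^sub>F k in sequentially. l - e < inner (y k) v"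
        by (intro order_tendstoD(1)[OF l]) simp
      then have "\<forall>\<^sub>F k in sequentially. inner (y k) (- v) \<le> - l + e" by eventually_elim simp
      then show "inner w (- v) \<le> - l + e" by (rule half[OF w])
    qed
    then show "l \<le> inner w v" by simp
  qed
  have dist_conv: "convergent (\<lambda>k. (norm (y k - z))\<^sup>2)" if "z \<in> S" for z
  proof -
    have "decseq (\<lambda>k. norm (y k - z))" using fejer[OF that] by (simp add: decseq_Suc_iff)
    then obtain l where "(\<lambda>k. norm (y k - z)) \<longlonglongrightarrow> l"
      using decseq_convergent[of "\<lambda>k. norm (y k - z)" 0] by auto
    then have "(\<lambda>k. (norm (y k - z))\<^sup>2) \<longlonglongrightarrow> l\<^sup>2" by (intro tendsto_intros)
    then show ?thesis by (auto simp: convergent_def)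
  qed
  \<comment> \<open>Distances to both points converge, so by polarization
    \<open>inner (y k) (z - z')\<close> converges; its limit must equal the value at both
    \<open>z\<close> and \<open>z'\<close>.\<close>
  have uniq: "z = z'" if z: "\<And>n. z \<in> K n" and z': "\<And>n. z' \<in> K n" for z z'
  proof -
    obtain l where l: "(\<lambda>k. (norm (y k - z))\<^sup>2) \<longlonglongrightarrow> l"
      using dist_conv[OF KS[OF z]] by (auto simp: convergent_def)
    obtain l' where l': "(\<lambda>k. (norm (y k - z'))\<^sup>2) \<longlonglongrightarrow> l'"
      using dist_conv[OF KS[OF z']] by (auto simp: convergent_def)
    have "(\<lambda>k. ((norm (y k - z'))\<^sup>2 - (norm (y k - z))\<^sup>2 + (norm z)\<^sup>2 - (norm z')\<^sup>2) / 2)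
        \<longlonglongrightarrow> (l' - l + (norm z)\<^sup>2 - (norm z')\<^sup>2) / 2"
      by (intro tendsto_intros l l') simp
    moreover have "((norm (y k - z'))\<^sup>2 - (norm (y k - z))\<^sup>2 + (norm z)\<^sup>2 - (norm z')\<^sup>2) / 2
        = inner (y k) (z - z')" for k
      by (simp add: power2_norm_eq_inner inner_commute algebra_simps) (simp add: field_simps)
    ultimately have "(\<lambda>k. inner (y k) (z - z')) \<longlonglongrightarrow> (l' - l + (norm z)\<^sup>2 - (norm z')\<^sup>2) / 2"
      by simp
    from lim_unique[OF z this] lim_unique[OF z' this] have "inner (z - z') (z - z') = 0"
      by (simp add: inner_diff_left)
    then show ?thesis by simp
  qed
  have "(\<Inter>n. K n) \<noteq> {}"
    by (rule nested_closed_convex_bounded_nonempty[of K]) (use clK cvK bdK decK yK in blast)+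
  then obtain z where z: "\<And>n. z \<in> K n" by blast
  \<comment> \<open>Otherwise the tail hulls, cut with a half-space that excludes \<open>z\<close>, would still have a common point.\<close>
  have above: "\<forall>\<^sub>F k in sequentially. inner (y k) v < inner z v + e" if e: "e > 0" for v e
  proof (rule ccontr)
    assume "\<not> ?thesis"
    then have "\<exists>k\<ge>n. inner z v + e \<le> inner (y k) v" for n
      by (force simp: eventually_sequentially not_less)
    then have ne': "K n \<inter> {x. inner v x \<ge> inner z v + e} \<noteq> {}" for n
      using yK by (fastforce simp: inner_commute)
    have "(\<Inter>n. K n \<inter> {x. inner v x \<ge> inner z v + e}) \<noteq> {}"
    proof (rule nested_closed_convex_bounded_nonempty)
      show "closed (K n \<inter> {x. inner v x \<ge> inner z v + e})" for n
        by (intro closed_Int clK closed_halfspace_ge)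
      show "convex (K n \<inter> {x. inner v x \<ge> inner z v + e})" for n
        by (intro convex_Int cvK convex_halfspace_ge)
      show "bounded (K 0 \<inter> {x. inner v x \<ge> inner z v + e})"
        using bdK by (rule bounded_subset) auto
    qed (use ne' decK in auto)
    then obtain w where w: "\<And>n. w \<in> K n" "inner v w \<ge> inner z v + e" by blast
    with uniq[OF w(1) z] e show False by (simp add: inner_commute)
  qed
  have "(\<lambda>k. inner (y k) v) \<longlonglongrightarrow> inner z v" for v
  proof (rule order_tendstoI)
    fix c assume "c < inner z v"
    then show "\<forall>\<^sub>F k in sequentially. c < inner (y k) v"
      using above[of "inner z v - c" "- v"] by simp
  next
    fix c assume "inner z v < c"
    then show "\<forall>\<^sub>F k in sequentially. inner (y k) v < c"
      using above[of "c - inner z v" v] by simp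
  qed
  then show ?thesis unfolding weakly_converges_def using KS[OF z] by blast
qed

section \<open>The proximal iteration: rate and weak convergence\<close>

theorem mainTheorem13:
  fixes f :: "'a::{real_inner, complete_space} \<Rightarrow> real"
    and g :: "'a \<Rightarrow> 'a"
    and p :: real
    and ym1 :: 'a
    and y :: "nat \<Rightarrow> 'a"
  assumes convex: "convex_on UNIV f"
    and grad: "\<And>x. (f has_derivative (\<lambda>h. inner (g x) h)) (at x)"
    and grad_cont: "continuous_on UNIV g"
    and grad_lip: "\<And>B. bounded B \<Longrightarrow> \<exists>L. L-lipschitz_on B g"
    and S_ne: "\<exists>x. \<forall>z. f x \<le> f z"
    and p: "p \<ge> 1"
    and init: "y 0 \<noteq> ym1"
    and rec: "\<And>k. y (Suc k) =
        prox ((norm (y k - (if k = 0 then ym1 else y (k - 1)))) powr (-((p - 1) / p))) f (y k)"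
    and nonstat: "\<And>k. g (y k) \<noteq> 0"
  shows "(\<lambda>k. f (y k) - (INF x. f x)) \<in> o(\<lambda>k. real k powr (-(2 - 1 / p)))
         \<and> (\<exists>x. (\<forall>z. f x \<le> f z) \<and> weakly_converges y x)"
proof -
  define a where "a = (p - 1) / p"
  have a: "a \<ge> 0" and a2: "2 - 1 / p = 1 + a" using p by (auto simp: a_def field_simps)
  define d where "d k = norm (y k - (if k = 0 then ym1 else y (k - 1)))" for k
  define lam where "lam k = d k powr (- a)" for k
  obtain xs where xs: "\<And>z. f xs \<le> f z" using S_ne by blast
  have INF: "(INF x. f x) = f xs"
    by (rule cInf_eq_minimum) (use xs in auto)
  \<comment> \<open>The condition \<open>d k > 0\<close> stays for now: its proof by induction uses
    this step, a nonzero gradient forcing the next iterate to move.\<close>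
  have step: "y (Suc k) = y k - lam k *\<^sub>R g (y (Suc k))" if "d k > 0" for k
  proof -
    have "lam k > 0" using that by (simp add: lam_def)
    moreover have "y (Suc k) = prox (lam k) f (y k)"
      using rec[of k] by (simp add: lam_def d_def a_def)
    ultimately show ?thesis
      using prox_stationary[of f g "f xs" "lam k" "y k", OF convex grad xs] by simp
  qed
  have d: "d k > 0" for k
  proof (induction k)
    case 0
    then show ?case using init by (simp add: d_def)
  next
    case (Suc k)
    have "lam k > 0" using Suc by (simp add: lam_def)
    then have "lam k *\<^sub>R g (y (Suc k)) \<noteq> 0" using nonstat[of "Suc k"] by simp
    then have "y (Suc k) \<noteq> y k" using step[OF Suc] by (metis diff_0_right diff_left_imp_eq)
    then show ?case by (simp add: d_def)
  qed
  have lam: "lam k > 0" for k using d[of k] by (simp add: lam_def)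
  have diff: "y k - y (Suc k) = lam k *\<^sub>R g (y (Suc k))" for k
    using step[OF d, of k] by (metis add_diff_cancel_left' diff_add_cancel)
  define F where "F k = f (y k) - f xs" for k
  have F0: "F k \<ge> 0" for k using xs by (simp add: F_def)
  \<comment> \<open>\<open>d k powr a\<close> is the inverse of \<open>lam k\<close>, so the left
    side is \<open>lam k\<close> times the squared gradient norm, which the gradient inequality
    bounds.\<close>
  have descent: "(d (Suc k))\<^sup>2 * d k powr a \<le> F k - F (Suc k)" for k
  proof -
    have "d (Suc k) = lam k * norm (g (y (Suc k)))"
      using diff[of k] lam[of k] by (simp add: d_def norm_minus_commute[of "y (Suc k)"])
    then have "(d (Suc k))\<^sup>2 * d k powr a = (lam k * d k powr a) * (lam k * (norm (g (y (Suc k))))\<^sup>2)"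
      by (simp add: power2_eq_square)
    also have "lam k * d k powr a = 1" using d[of k] by (simp add: lam_def powr_minus)
    also have "1 * (lam k * (norm (g (y (Suc k))))\<^sup>2) = inner (g (y (Suc k))) (y k - y (Suc k))"
      by (simp add: diff power2_norm_eq_inner)
    also have "\<dots> \<le> F k - F (Suc k)"
      using convex_on_gradient_inequality[of f g "y (Suc k)" "y k", OF convex grad] by (simp add: F_def)
    finally show ?thesis .
  qed
  have dec: "F (Suc k) \<le> F k" for k
    using descent[of k] by (smt (verit) mult_nonneg_nonneg powr_ge_zero zero_le_power2)
  \<comment> \<open>Used twice: summed at \<open>xs\<close> it bounds the weighted values, and at
    any minimizer it gives Fejer monotonicity.\<close>
  have energy: "(norm (y (Suc k) - z))\<^sup>2 + 2 * (lam k * F (Suc k)) \<le> (norm (y k - z))\<^sup>2"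
    if z: "\<And>x. f z \<le> f x" for z k
  proof -
    have "f z = f xs" using z xs by (intro antisym)
    then have "F (Suc k) \<le> inner (g (y (Suc k))) (y (Suc k) - z)"
      using convex_on_gradient_inequality[of f g "y (Suc k)" z, OF convex grad]
      by (simp add: F_def inner_diff_right)
    then have "lam k * F (Suc k) \<le> inner (y k - y (Suc k)) (y (Suc k) - z)"
      using lam[of k] by (simp add: diff)
    moreover have "(norm (y k - z))\<^sup>2 = (norm (y (Suc k) - z))\<^sup>2 + (norm (y k - y (Suc k)))\<^sup>2
        + 2 * inner (y k - y (Suc k)) (y (Suc k) - z)"
      by (simp add: power2_norm_eq_inner inner_commute algebra_simps)
    ultimately show ?thesis using zero_le_power2[of "norm (y k - y (Suc k))"] by linarith
  qed
  define C where "C = (norm (y 0 - xs))\<^sup>2 / 2"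
  have sumF: "(\<Sum>k<n. lam k * F (Suc k)) \<le> C" for n
  proof -
    have "(norm (y n - xs))\<^sup>2 + 2 * (\<Sum>k<n. lam k * F (Suc k)) \<le> (norm (y 0 - xs))\<^sup>2"
    proof (induction n)
      case (Suc n)
      then show ?case using energy[OF xs, of n] by (simp add: distrib_left)
    qed simp
    then show ?thesis using zero_le_power2[of "norm (y n - xs)"] unfolding C_def by linarith
  qed
  define t where "t n = (\<Sum>j<n. lam j)" for n
  have t0: "t n \<ge> 0" for n unfolding t_def by (intro sum_nonneg less_imp_le lam)
  have "(\<Sum>k<n. t k * ((d (Suc k))\<^sup>2 * d k powr a)) \<le> C" for n
  proof -
    have "(\<Sum>k<n. t k * ((d (Suc k))\<^sup>2 * d k powr a)) \<le> (\<Sum>k<n. t k * (F k - F (Suc k)))"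
      by (intro sum_mono mult_left_mono descent t0)
    also have "\<dots> \<le> (\<Sum>k<n. lam k * F (Suc k))"
      using telescoped_sum_eq[of t lam F n, OF t_def] t0[of n] F0[of n]
      by (smt (verit) mult_nonneg_nonneg)
    finally show ?thesis using sumF[of n] by linarith
  qed
  then obtain \<kappa> where \<kappa>: "\<kappa> > 0" and tk: "\<And>n. n \<ge> 1 \<Longrightarrow> t n \<ge> \<kappa> * real n powr (1 + a)"
    using step_sum_growth[of a d t C, OF a d] t_def lam_def by auto
  \<comment> \<open>As \<open>a \<ge> 0\<close>, the lower bound on \<open>t\<close> is at least
    linear.\<close>
  have tinf: "filterlim t at_top sequentially"
  proof (rule filterlim_at_top_mono)
    show "filterlim (\<lambda>n. \<kappa> * real n) at_top sequentially"
      by (rule filterlim_tendsto_pos_mult_at_top[OF tendsto_const \<kappa> filterlim_real_sequentially])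
    have "\<kappa> * real n \<le> t n" if "n \<ge> 1" for n
    proof -
      have "real n powr 1 \<le> real n powr (1 + a)" using that a by (intro powr_mono) auto
      then have "\<kappa> * real n \<le> \<kappa> * real n powr (1 + a)" using \<kappa> that by simp
      then show ?thesis using tk[OF that] by linarith
    qed
    then show "\<forall>\<^sub>F n in sequentially. \<kappa> * real n \<le> t n" by (rule eventually_sequentiallyI)
  qed
  note lims = antimono_weighted_tendsto_0[of F lam t, OF F0 dec less_imp_le[OF lam] t_def tinf sumF]
  have "(\<lambda>k. F k) \<in> o(\<lambda>k. real k powr (- (1 + a)))"
  proof (rule smalloI_tendsto)
    show "\<forall>\<^sub>F k in sequentially. real k powr (- (1 + a)) \<noteq> 0"
      by (rule eventually_sequentiallyI[of 1]) simp
    have le: "\<forall>\<^sub>F k in sequentially. F k / real k powr (- (1 + a)) \<le> t k * F k / \<kappa>"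
    proof (rule eventually_sequentiallyI[of 1])
      fix k :: nat assume k: "1 \<le> k"
      have "F k / real k powr (- (1 + a)) = (\<kappa> * real k powr (1 + a)) * F k / \<kappa>"
        unfolding powr_minus_divide using \<kappa> by simp
      also have "\<dots> \<le> t k * F k / \<kappa>"
        using \<kappa> F0 tk[OF k] by (intro divide_right_mono mult_right_mono) auto
      finally show "F k / real k powr (- (1 + a)) \<le> t k * F k / \<kappa>" .
    qed
    have ge: "\<forall>\<^sub>F k in sequentially. 0 \<le> F k / real k powr (- (1 + a))"
      using F0 by (intro always_eventually allI divide_nonneg_nonneg) auto
    have "(\<lambda>k. t k * F k / \<kappa>) \<longlonglongrightarrow> 0 / \<kappa>"
      by (intro tendsto_divide lims(1) tendsto_const) (use \<kappa> in simp)
    then have "(\<lambda>k. t k * F k / \<kappa>) \<longlonglongrightarrow> 0" by simp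
    then show "(\<lambda>k. F k / real k powr (- (1 + a))) \<longlonglongrightarrow> 0"
      by (rule tendsto_sandwich[OF ge le tendsto_const])
  qed
  then have rate: "(\<lambda>k. f (y k) - (INF x. f x)) \<in> o(\<lambda>k. real k powr (- (2 - 1 / p)))"
    unfolding INF a2 F_def .
  have cont: "continuous_on UNIV f"
    by (intro continuous_at_imp_continuous_on ballI has_derivative_continuous[OF grad])
  have "\<exists>z\<in>{x. \<forall>z. f x \<le> f z}. weakly_converges y z"
  proof (rule fejer_monotone_weakly_converges)
    fix z k assume "z \<in> {x. \<forall>z. f x \<le> f z}"
    then have "(norm (y (Suc k) - z))\<^sup>2 + 2 * (lam k * F (Suc k)) \<le> (norm (y k - z))\<^sup>2"
      by (intro energy) auto
    moreover have "lam k * F (Suc k) \<ge> 0" using lam F0 by (simp add: less_imp_le)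
    ultimately have "(norm (y (Suc k) - z))\<^sup>2 \<le> (norm (y k - z))\<^sup>2" by linarith
    then show "norm (y (Suc k) - z) \<le> norm (y k - z)" by (rule power2_le_imp_le) simp
  next
    show "{x. \<forall>z. f x \<le> f z} \<noteq> {}" using xs by blast
  next
    \<comment> \<open>Each sublevel set at height \<open>f (y n)\<close> is closed, convex and
      contains the tail from \<open>n\<close>, so \<open>f z\<close> is at most every
      \<open>f (y n)\<close> and therefore minimal.\<close>
    fix z assume hull: "\<And>C n. closed C \<Longrightarrow> convex C \<Longrightarrow> y ` {n..} \<subseteq> C \<Longrightarrow> z \<in> C"
    have "f z \<le> f (y n)" for n
    proof -
      have "z \<in> {x. f x \<le> f (y n)}"
      proof (rule hull)
        show "closed {x. f x \<le> f (y n)}" by (intro closed_Collect_le cont continuous_on_const)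
        show "convex {x. f x \<le> f (y n)}" by (rule convex_on_sublevel_convex[OF convex])
        show "y ` {n..} \<subseteq> {x. f x \<le> f (y n)}"
          using lift_Suc_antimono_le[of F, OF dec] by (auto simp: F_def)
      qed
      then show ?thesis by simp
    qed
    then have "f z - f xs \<le> F n" for n by (simp add: F_def)
    then have "f z - f xs \<le> 0" by (intro LIMSEQ_le_const[OF lims(2)]) auto
    then show "z \<in> {x. \<forall>z. f x \<le> f z}" using xs by (auto intro: order_trans)
  qed
  with rate show ?thesis by blast
qed

end
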